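(* Let $a,b>0$ and define sequences by $a_0:=a$, $b_0:=b$ and, for $n\ge 0$, $$a_{n+1}:=\frac{a_n+2b_n}{3},\qquad b_{n+1}:=\sqrt[3]{\frac{b_n(a_n^2+a_nb_n+b_n^2)}{3}}.$$ Then when $a=x\in(0,1)$ and $b=1$, the common limit $L(x,1)$ of $\{a_n\}$ and $\{b_n\}$ is given by $$\frac{1}{L(x,1)}=\sum_{n=0}^\infty\frac{(1/3,n)^2}{(n!)^2}(1-x^3)^n=F\left(\tfrac13,\tfrac13;1;1-x^3\right).$$ In particular, for $x\in(0,1)$, $$F\left(\tfrac13,\tfrac13;1;1-x^3\right)=\sqrt[3]{\frac{3}{x^2+x+1}}\;F\left(\tfrac13,\tfrac13;1;\frac{(1-x)^3}{9(x^2+x+1)}\right).$$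
   Context: $F(\alpha,\beta;c;x)=\sum_{n=0}^\infty \frac{(\alpha,n)(\beta,n)}{(c,n)}\frac{x^n}{n!}$ is the Gaussian hypergeometric function for $x\in(-1,1)$, where $(\alpha,n)=\alpha(\alpha+1)\cdots(\alpha+n-1)$, $(\alpha,0)=1$. $L(a,b)$ denotes the common limit of the two sequences started at $a_0=a$, $b_0=b$ (the paper writes $F(a,b)$ for this limit). *)

theory Defs
  imports Complex_Main
begin

(* Gaussian hypergeometric series; meaningful for x in (-1,1). *)
definition hypergeom :: "real \<Rightarrow> real \<Rightarrow> real \<Rightarrow> real \<Rightarrow> real" where
  "hypergeom \<alpha> \<beta> c x =
     (\<Sum>n. pochhammer \<alpha> n * pochhammer \<beta> n / pochhammer c n * (x ^ n / fact n))"

fun cubic_a :: "real \<Rightarrow> real \<Rightarrow> nat \<Rightarrow> real"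
  and cubic_b :: "real \<Rightarrow> real \<Rightarrow> nat \<Rightarrow> real" where
  "cubic_a a b 0 = a"
| "cubic_b a b 0 = b"
| "cubic_a a b (Suc n) = (cubic_a a b n + 2 * cubic_b a b n) / 3"
| "cubic_b a b (Suc n) =
     root 3 (cubic_b a b n *
       ((cubic_a a b n)\<^sup>2 + cubic_a a b n * cubic_b a b n + (cubic_b a b n)\<^sup>2) / 3)"

(* The common limit of the two sequences. Where there is none, the
   value is unspecified. *)
definition cubic_mean :: "real \<Rightarrow> real \<Rightarrow> real" where
  "cubic_mean a b = (THE l. cubic_a a b \<longlonglongrightarrow> l \<and> cubic_b a b \<longlonglongrightarrow> l)"

end

theory Submission
  imports Defs
begin

text \<open>
  Put $G(x) = F(1/3, 1/3; 1; 1 - x^3)$. One step of the iteration maps the ratio $x = a/b$ to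
  $w = (x + 2)/(3 s)$ and scales $b$ by $s = ((x^2 + x + 1)/3)^{1/3}$, so everything follows from
  the functional equation $G(x) = G(w)/s$: it makes $G(a_n/b_n)/b_n$ independent of $n$, and this
  quantity tends to $G(1)/L = 1/L$. The hypergeometric equation turns into the self-adjoint
  equation $((1 - x^3) y')' = x y$ for $G$. Since $1 - w^3 = (1 - x)^3/(27 s^3)$ and
  $w' = (1 - x)^2/(27 s^4)$, the function $G(w)/s$ satisfies the same equation. At the singular
  point $x = 1$ both solutions are smooth with value 1, which forces them to agree.
\<close>

section \<open>Uniqueness at a singular point of a self-adjoint equation\<close>

text \<open>
  The weighted Wronskian $p (u v' - v u')$ is constant and vanishes at the singular point $c$.
\<close>
lemma singular_sturm_liouville_unique:
  fixes u v u' v' U V p q :: "real \<Rightarrow> real"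
  assumes c: "a < c" "c < b" "p c = 0" "u c = v c"
    and p: "\<And>x. a < x \<Longrightarrow> x < c \<Longrightarrow> p x \<noteq> 0"
    and pos: "\<And>x. a < x \<Longrightarrow> x \<le> c \<Longrightarrow> u x > 0"
    and u: "\<And>x. a < x \<Longrightarrow> x < b \<Longrightarrow> (u has_real_derivative u' x) (at x)"
    and v: "\<And>x. a < x \<Longrightarrow> x < b \<Longrightarrow> (v has_real_derivative v' x) (at x)"
    and U_eq: "\<And>x. a < x \<Longrightarrow> x < b \<Longrightarrow> U x = p x * u' x"
    and V_eq: "\<And>x. a < x \<Longrightarrow> x < b \<Longrightarrow> V x = p x * v' x"
    and U: "\<And>x. a < x \<Longrightarrow> x < b \<Longrightarrow> (U has_real_derivative q x * u x) (at x)"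
    and V: "\<And>x. a < x \<Longrightarrow> x < b \<Longrightarrow> (V has_real_derivative q x * v x) (at x)"
    and x: "a < x" "x < c"
  shows "u x = v x"
proof -
  \<comment> \<open>In terms of \<open>U\<close> and \<open>V\<close> the weighted Wronskian is
    differentiable without second derivatives of \<open>u\<close> and \<open>v\<close>; the
    \<open>q\<close> terms cancel, and so do the products \<open>p * u' * v'\<close>.\<close>
  define W where "W = (\<lambda>x. u x * V x - v x * U x)"
  have W_deriv: "(W has_real_derivative 0) (at y)" if "a < y" "y < b" for y
    unfolding W_def
    using that by (auto intro!: derivative_eq_intros u v U V simp: U_eq V_eq algebra_simps)
  have W_zero: "W y = 0" if "a < y" "y \<le> c" for y
  proof -
    have "W c = W y"
    proof (cases "y = c")
      case False
      then have "y < c" using that by simp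
      then show ?thesis
        using that c by (intro DERIV_isconst_end[of y c W] W_deriv
            DERIV_continuous_on[where D = "\<lambda>_. 0"])
          (auto intro!: has_field_derivative_at_within[OF W_deriv])
    qed simp
    moreover have "W c = 0" using c U_eq[of c] V_eq[of c] by (simp add: W_def)
    ultimately show ?thesis by simp
  qed
  have wronskian: "u y * v' y = v y * u' y" if "a < y" "y < c" for y
  proof -
    have "p y * (u y * v' y - v y * u' y) = 0"
      using W_zero[of y] that c U_eq[of y] V_eq[of y] by (simp add: W_def algebra_simps)
    then show ?thesis using p[OF that] by simp
  qed
  \<comment> \<open>Away from \<open>c\<close> the factor \<open>p\<close> can be cancelled, so v/u
    has derivative 0 on (x, c). Continuity extends the constant to \<open>c\<close>, where
    \<open>u c = v c\<close> makes it 1.\<close>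
  have cont: "continuous_on {x..c} (\<lambda>y. v y / u y)"
  proof (intro continuous_on_divide)
    show "continuous_on {x..c} v" "continuous_on {x..c} u"
      by (rule DERIV_continuous_on[OF has_field_derivative_at_within]; use x c in \<open>force intro: u v\<close>)+
    show "\<forall>y\<in>{x..c}. u y \<noteq> 0" using pos[THEN less_imp_neq] x by force
  qed
  have "((\<lambda>y. v y / u y) has_real_derivative 0) (at y)" if "x < y" "y < c" for y
  proof -
    have "u y \<noteq> 0" using pos[of y] that x by auto
    then show ?thesis
      using that x c wronskian[of y]
      by (auto intro!: derivative_eq_intros u v simp: mult.commute)
  qed
  with cont x have "v c / u c = v x / u x"
    by (intro DERIV_isconst_end) auto
  moreover have "u c > 0" "u x > 0" using pos[of c] pos[of x] c x by simp_all
  ultimately show ?thesis using c by (simp add: field_simps)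
qed

section \<open>The series F(\<alpha>, \<beta>; 1; z) and its differential equation\<close>

text \<open>Taylor coefficient for c = 1: there \<open>pochhammer 1 n = fact n\<close>, which joins
  the factorial already present and gives the square.\<close>

definition hypergeom_coeff :: "real \<Rightarrow> real \<Rightarrow> nat \<Rightarrow> real" where
  "hypergeom_coeff \<alpha> \<beta> n = pochhammer \<alpha> n * pochhammer \<beta> n / (fact n)\<^sup>2"

lemma hypergeom_1_eq: "hypergeom \<alpha> \<beta> 1 x = (\<Sum>n. hypergeom_coeff \<alpha> \<beta> n * x ^ n)"
  by (simp add: hypergeom_def hypergeom_coeff_def pochhammer_fact[symmetric] power2_eq_square)

text \<open>The ratio of consecutive coefficients with denominators cleared; this is the
  hypergeometric equation read off coefficientwise.\<close>

lemma hypergeom_coeff_Suc: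
  "(real n + 1)\<^sup>2 * hypergeom_coeff \<alpha> \<beta> (Suc n) =
     (real n + \<alpha>) * (real n + \<beta>) * hypergeom_coeff \<alpha> \<beta> n"
proof -
  have "(fact (Suc n) :: real)\<^sup>2 = (real n + 1)\<^sup>2 * (fact n)\<^sup>2"
    by (simp add: power_mult_distrib add.commute)
  moreover have "(real n + 1)\<^sup>2 \<noteq> 0" by simp
  ultimately have "(real n + 1)\<^sup>2 * hypergeom_coeff \<alpha> \<beta> (Suc n) =
      pochhammer \<alpha> (Suc n) * pochhammer \<beta> (Suc n) / (fact n)\<^sup>2"
    unfolding hypergeom_coeff_def by (simp del: fact_Suc pochhammer_Suc)
  also have "\<dots> = (real n + \<alpha>) * (real n + \<beta>) * hypergeom_coeff \<alpha> \<beta> n"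
    by (simp add: hypergeom_coeff_def pochhammer_Suc mult_ac add.commute)
  finally show ?thesis .
qed

text \<open>For parameters in [0, 1] each Pochhammer factor t + k is at most 1 + k. The upper bound
  allows comparison with a geometric series.\<close>

lemma hypergeom_coeff_bounds:
  assumes "0 \<le> \<alpha>" "\<alpha> \<le> 1" "0 \<le> \<beta>" "\<beta> \<le> 1"
  shows "0 \<le> hypergeom_coeff \<alpha> \<beta> n \<and> hypergeom_coeff \<alpha> \<beta> n \<le> 1"
proof -
  have poch: "0 \<le> pochhammer t n \<and> pochhammer t n \<le> fact n" if "0 \<le> t" "t \<le> 1" for t :: real
  proof (induction n)
    case (Suc n)
    then have "pochhammer t n * (t + real n) \<le> fact n * (1 + real n)"
      using that by (intro mult_mono) auto
    then show ?case using Suc that by (simp add: pochhammer_Suc algebra_simps)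
  qed simp
  have "pochhammer \<alpha> n * pochhammer \<beta> n \<le> fact n * fact n"
    using poch assms by (intro mult_mono) auto
  then show ?thesis
    using poch assms by (simp add: hypergeom_coeff_def power2_eq_square)
qed

lemma summable_hypergeom_coeff:
  assumes "0 \<le> \<alpha>" "\<alpha> \<le> 1" "0 \<le> \<beta>" "\<beta> \<le> 1" "norm x < 1"
  shows "summable (\<lambda>n. hypergeom_coeff \<alpha> \<beta> n * x ^ n)"
proof (rule summable_comparison_test')
  show "summable (\<lambda>n. norm x ^ n)" using assms by (simp add: summable_geometric)
  show "norm (hypergeom_coeff \<alpha> \<beta> n * x ^ n) \<le> norm x ^ n" if "n \<ge> 0" for n
    using hypergeom_coeff_bounds[OF assms(1-4), of n]
    by (simp add: abs_mult power_abs mult_left_le_one_le)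
qed

text \<open>All terms are nonnegative and the constant term is 1. This supplies the positivity of
  \<open>u\<close> required by the uniqueness lemma.\<close>

lemma hypergeom_1_ge_1:
  assumes "0 \<le> \<alpha>" "\<alpha> \<le> 1" "0 \<le> \<beta>" "\<beta> \<le> 1" "0 \<le> x" "x < 1"
  shows "1 \<le> hypergeom \<alpha> \<beta> 1 x"
proof -
  have "(\<Sum>n\<in>{0}. hypergeom_coeff \<alpha> \<beta> n * x ^ n) \<le> (\<Sum>n. hypergeom_coeff \<alpha> \<beta> n * x ^ n)"
    using assms hypergeom_coeff_bounds[of \<alpha> \<beta>]
    by (intro sum_le_suminf summable_hypergeom_coeff) auto
  then show ?thesis by (simp add: hypergeom_1_eq hypergeom_coeff_def)
qed

text \<open>\<open>F'\<close> and \<open>F''\<close> are the termwise derivatives; each term of the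
  equation is expanded in powers of z and the coefficients are matched by the recurrence.\<close>

lemma hypergeom_1_ode:
  assumes "0 \<le> \<alpha>" "\<alpha> \<le> 1" "0 \<le> \<beta>" "\<beta> \<le> 1"
  obtains F' F'' where
    "\<And>z. norm z < 1 \<Longrightarrow> (hypergeom \<alpha> \<beta> 1 has_real_derivative F' z) (at z)"
    "\<And>z. norm z < 1 \<Longrightarrow> (F' has_real_derivative F'' z) (at z)"
    "\<And>z. norm z < 1 \<Longrightarrow>
       z * (1 - z) * F'' z + (1 - (\<alpha> + \<beta> + 1) * z) * F' z = \<alpha> * \<beta> * hypergeom \<alpha> \<beta> 1 z"
proof
  let ?c = "hypergeom_coeff \<alpha> \<beta>"
  define F' where "F' = (\<lambda>z. \<Sum>n. diffs ?c n * z ^ n)"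
  define F'' where "F'' = (\<lambda>z. \<Sum>n. diffs (diffs ?c) n * z ^ n)"
  have s0: "summable (\<lambda>n. ?c n * z ^ n)" if "norm z < 1" for z
    using summable_hypergeom_coeff assms that by blast
  have s1: "summable (\<lambda>n. diffs ?c n * z ^ n)" if "norm z < 1" for z
    using termdiff_converges[OF that s0] .
  have s2: "summable (\<lambda>n. diffs (diffs ?c) n * z ^ n)" if "norm z < 1" for z
    using termdiff_converges[OF that s1] .
  have F_eq: "hypergeom \<alpha> \<beta> 1 = (\<lambda>z. \<Sum>n. ?c n * z ^ n)"
    by (simp add: hypergeom_1_eq fun_eq_iff)
  show "(hypergeom \<alpha> \<beta> 1 has_real_derivative F' z) (at z)" if "norm z < 1" for z
    unfolding F_eq F'_def using termdiffs_strong'[OF s0 that] .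
  show "(F' has_real_derivative F'' z) (at z)" if "norm z < 1" for z
    unfolding F''_def F'_def using termdiffs_strong'[OF s1 that] .
  show "z * (1 - z) * F'' z + (1 - (\<alpha> + \<beta> + 1) * z) * F' z = \<alpha> * \<beta> * hypergeom \<alpha> \<beta> 1 z"
    if z: "norm z < 1" for z
  proof -
    \<comment> \<open>For n = 0 the exponent is truncated to 0, but the factor \<open>real n\<close>
      vanishes.\<close>
    have pow: "real n * a * z ^ (n - Suc 0) * z = real n * a * z ^ n" for n a
      by (cases n) auto
    have t0: "(\<lambda>n. ?c n * z ^ n) sums hypergeom \<alpha> \<beta> 1 z"
      unfolding hypergeom_1_eq using s0[OF z] by (rule summable_sums)
    have t1: "(\<lambda>n. (real n + 1) * ?c (Suc n) * z ^ n) sums F' z"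
      using summable_sums[OF s1[OF z]] by (simp add: F'_def diffs_def algebra_simps)
    have t1z: "(\<lambda>n. real n * ?c n * z ^ n) sums (F' z * z)"
      using sums_mult2[OF diffs_equiv[OF s1[OF z]], of z] by (simp only: F'_def pow)
    have t2z: "(\<lambda>n. real n * ((real n + 1) * ?c (Suc n)) * z ^ n) sums (F'' z * z)"
      using sums_mult2[OF diffs_equiv[OF s2[OF z]], of z]
      by (simp only: F''_def pow) (simp add: diffs_def algebra_simps)
    have "(\<lambda>n. (real (Suc n) - 1) * real (Suc n) * ?c (Suc n) * z ^ Suc n) sums (F'' z * z * z)"
      using sums_mult2[OF t2z, of z] by (simp add: algebra_simps)
    \<comment> \<open>Undoes the index shift; the added term at n = 0 is zero.\<close>
    then have t2zz: "(\<lambda>n. (real n - 1) * real n * ?c n * z ^ n) sums (F'' z * z * z)"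
      by (subst (asm) sums_Suc_iff) simp
    \<comment> \<open>The four summands are the coefficients of z F'', z^2 F'', F' and (\<alpha> +
      \<beta> + 1) z F'. The first and third combine to (n + 1)^2 times the next
      coefficient.\<close>
    have rec: "real n * ((real n + 1) * ?c (Suc n)) - (real n - 1) * real n * ?c n
        + (real n + 1) * ?c (Suc n) - (\<alpha> + \<beta> + 1) * (real n * ?c n) = \<alpha> * \<beta> * ?c n" for n
      using hypergeom_coeff_Suc[of n \<alpha> \<beta>] by (simp add: algebra_simps power2_eq_square)
    have "(\<lambda>n. real n * ((real n + 1) * ?c (Suc n)) * z ^ n - (real n - 1) * real n * ?c n * z ^ n
        + (real n + 1) * ?c (Suc n) * z ^ n - (\<alpha> + \<beta> + 1) * (real n * ?c n * z ^ n))
        sums (F'' z * z - F'' z * z * z + F' z - (\<alpha> + \<beta> + 1) * (F' z * z))"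
      by (intro sums_add sums_diff sums_mult t1 t1z t2z t2zz)
    moreover have "real n * ((real n + 1) * ?c (Suc n)) * z ^ n - (real n - 1) * real n * ?c n * z ^ n
        + (real n + 1) * ?c (Suc n) * z ^ n - (\<alpha> + \<beta> + 1) * (real n * ?c n * z ^ n)
        = \<alpha> * \<beta> * (?c n * z ^ n)" for n
      using arg_cong[OF rec[of n], of "\<lambda>t. t * z ^ n"] by (simp add: algebra_simps)
    ultimately have "(\<lambda>n. \<alpha> * \<beta> * (?c n * z ^ n))
        sums (F'' z * z - F'' z * z * z + F' z - (\<alpha> + \<beta> + 1) * (F' z * z))"
      by simp
    from sums_unique2[OF this sums_mult[OF t0, of "\<alpha> * \<beta>"]]
    show ?thesis by (simp add: algebra_simps)
  qed
qed

section \<open>The function G and its functional equation\<close>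

text \<open>The claimed value of \<open>1 / cubic_mean x 1\<close>.\<close>

definition cubic_G :: "real \<Rightarrow> real" where
  "cubic_G x = hypergeom (1/3) (1/3) 1 (1 - x ^ 3)"

text \<open>Substitution z = 1 - x^3 in the hypergeometric equation. For x > 0 the condition x^3 < 2
  means |z| < 1, so the singular point x = 1 is interior to the domain.\<close>

lemma cubic_G_ode:
  obtains G' where
    "\<And>x. 0 < x \<Longrightarrow> x ^ 3 < 2 \<Longrightarrow> (cubic_G has_real_derivative G' x) (at x)"
    "\<And>x. 0 < x \<Longrightarrow> x ^ 3 < 2 \<Longrightarrow>
       ((\<lambda>x. (1 - x ^ 3) * G' x) has_real_derivative x * cubic_G x) (at x)"
proof -
  let ?F = "hypergeom (1/3) (1/3) 1"
  obtain F' F'' where F: "\<And>z. norm z < 1 \<Longrightarrow> (?F has_real_derivative F' z) (at z)"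
    "\<And>z. norm z < 1 \<Longrightarrow> (F' has_real_derivative F'' z) (at z)"
    and ode: "\<And>z. norm z < 1 \<Longrightarrow>
       z * (1 - z) * F'' z + (1 - (1/3 + 1/3 + 1) * z) * F' z = 1/3 * (1/3) * ?F z"
    by (rule hypergeom_1_ode[of "1/3" "1/3"]) auto
  have dz: "((\<lambda>x. 1 - x ^ 3) has_real_derivative - (3 * x\<^sup>2)) (at x)" for x :: real
    by (auto intro!: derivative_eq_intros)
  show thesis
  proof
    fix x :: real assume x: "0 < x" "x ^ 3 < 2"
    have "0 < x ^ 3" using x by simp
    then have z: "norm (1 - x ^ 3) < 1" using x by (auto simp: abs_less_iff)
    show "(cubic_G has_real_derivative F' (1 - x ^ 3) * - (3 * x\<^sup>2)) (at x)"
      unfolding cubic_G_def by (rule DERIV_chain2[OF F(1)[OF z] dz])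
    note d = DERIV_chain2[OF F(2)[OF z] dz]
    have "9 * (1 - x ^ 3) * x ^ 3 * F'' (1 - x ^ 3) + (15 * x ^ 3 - 6) * F' (1 - x ^ 3) = cubic_G x"
      using ode[OF z] by (simp add: cubic_G_def field_simps)
    \<comment> \<open>After multiplication by x the left side is exactly the expanded derivative of
      (1 - x^3) times the derivative of \<open>cubic_G\<close>.\<close>
    from arg_cong[OF this, of "\<lambda>t. x * t"]
    have eq: "9 * (1 - x ^ 3) * x ^ 4 * F'' (1 - x ^ 3) + (15 * x ^ 4 - 6 * x) * F' (1 - x ^ 3)
        = x * cubic_G x"
      by (simp add: algebra_simps eval_nat_numeral)
    show "((\<lambda>x. (1 - x ^ 3) * (F' (1 - x ^ 3) * - (3 * x\<^sup>2))) has_real_derivative x * cubic_G x) (at x)"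
      by (rule derivative_eq_intros dz d refl | simp)+
         (use eq in \<open>simp add: algebra_simps eval_nat_numeral\<close>)
  qed
qed

lemma cubic_G_1: "cubic_G 1 = 1"
  by (simp add: cubic_G_def hypergeom_1_eq) (simp add: hypergeom_coeff_def)

text \<open>Follows from \<open>singular_sturm_liouville_unique\<close> with singular point 1. The
  derivative facts are therefore proved beyond 1, up to 5/4.\<close>

lemma cubic_G_transform:
  assumes x: "0 < x" "x < 1"
  defines "s \<equiv> \<lambda>x. root 3 ((x\<^sup>2 + x + 1) / 3)"
  shows "cubic_G x = cubic_G ((x + 2) / (3 * s x)) / s x"
proof -
  obtain G' where
    G: "\<And>x. 0 < x \<Longrightarrow> x ^ 3 < 2 \<Longrightarrow> (cubic_G has_real_derivative G' x) (at x)"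
    and Q: "\<And>x. 0 < x \<Longrightarrow> x ^ 3 < 2 \<Longrightarrow>
       ((\<lambda>x. (1 - x ^ 3) * G' x) has_real_derivative x * cubic_G x) (at x)"
    by (rule cubic_G_ode) blast
  define Q where "Q = (\<lambda>x. (1 - x ^ 3) * G' x)"
  define w where "w = (\<lambda>x. (x + 2) / (3 * s x))"
  define w' where "w' = (\<lambda>x. (1 - x)\<^sup>2 / (27 * s x ^ 4))"
  define s' where "s' = (\<lambda>x. (2 * x + 1) / (9 * (s x)\<^sup>2))"
  \<comment> \<open>This is (1 - x^3) \<open>v'\<close> with the term in \<open>G' (w x)\<close>
    absorbed into \<open>Q (w x)\<close>. The derivative of \<open>Q\<close> is known, so no second
    derivative of \<open>cubic_G\<close> enters.\<close>
  define V where "V = (\<lambda>x. 3 * s x * Q (w x) - (1 - x) * (2 * x + 1) * cubic_G (w x) / (3 * s x))"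
  define v' where "v' = (\<lambda>x. (G' (w x) * w' x * s x - cubic_G (w x) * s' x) / (s x)\<^sup>2)"
  have quad: "0 < x\<^sup>2 + x + 1" if "0 < x" for x :: real
    using that by (simp add: add_pos_pos)
  have s_pos: "0 < s x" if "0 < x" for x
    using quad[OF that] by (simp add: s_def)
  have s3: "s x ^ 3 = (x\<^sup>2 + x + 1) / 3" if "0 < x" for x
    using quad[OF that] by (simp add: s_def)
  have ds: "(s has_real_derivative s' x) (at x)" if "0 < x" for x
  proof -
    have "((\<lambda>x::real. (x\<^sup>2 + x + 1) / 3) has_real_derivative (2 * x + 1) / 3) (at x)"
      by (auto intro!: derivative_eq_intros)
    from DERIV_chain2[OF DERIV_real_root[of 3] this] quad[OF that]
    show ?thesis by (simp add: s_def s'_def field_simps eval_nat_numeral)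
  qed
  have dw: "(w has_real_derivative w' x) (at x)" if "0 < x" for x
  proof -
    have "(w has_real_derivative (3 * s x - (x + 2) * (3 * s' x)) / (3 * s x)\<^sup>2) (at x)"
      unfolding w_def using s_pos[OF that]
      by (auto intro!: derivative_eq_intros ds that simp: power2_eq_square)
    moreover have "(3 * s x - (x + 2) * (3 * s' x)) / (3 * s x)\<^sup>2
        = (9 * s x ^ 3 - (x + 2) * (2 * x + 1)) / (27 * s x ^ 4)"
      using s_pos[OF that] by (simp add: s'_def field_simps eval_nat_numeral)
    moreover have "9 * s x ^ 3 - (x + 2) * (2 * x + 1) = (1 - x)\<^sup>2"
      unfolding s3[OF that] by (simp add: algebra_simps power2_eq_square)
    ultimately show ?thesis by (simp add: w'_def)
  qed
  have w3: "w x ^ 3 = (x + 2) ^ 3 / (9 * (x\<^sup>2 + x + 1))" if "0 < x" for x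
    using s3[OF that] by (simp add: w_def power_divide power_mult_distrib)
  \<comment> \<open>5/4 is a convenient endpoint past 1 whose cube, 125/64, is still below
    2.\<close>
  have cube_less: "x ^ 3 < 2" if "0 < x" "x < 5/4" for x :: real
  proof -
    have "x ^ 3 < (5/4) ^ 3" using that by (intro power_strict_mono) auto
    also have "(5/4) ^ 3 < (2::real)" by (simp add: power3_eq_cube)
    finally show ?thesis .
  qed
  have w_dom: "0 < w x \<and> w x ^ 3 < 2" if "0 < x" "x < 5/4" for x
  proof
    show "0 < w x" using s_pos that by (simp add: w_def)
    have "2 * (9 * (x\<^sup>2 + x + 1)) - (x + 2) ^ 3 = 10 + 6 * x + 12 * x\<^sup>2 - x ^ 3"
      by (simp add: algebra_simps power2_eq_square power3_eq_cube)
    then have "(x + 2) ^ 3 < 2 * (9 * (x\<^sup>2 + x + 1))"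
      using that cube_less[OF that] zero_le_power2[of x] by linarith
    then show "w x ^ 3 < 2" using quad[of x] that by (simp add: w3 field_simps)
  qed
  \<comment> \<open>Rests on 9 (x^2 + x + 1) - (x + 2)^3 = (1 - x)^3.\<close>
  have one_w3: "1 - w x ^ 3 = (1 - x) ^ 3 / (27 * s x ^ 3)" if "0 < x" for x
    unfolding w3[OF that] s3[OF that] using quad[OF that]
    by (simp add: field_simps) (simp add: algebra_simps eval_nat_numeral)
  have Qw: "Q (w x) = (1 - x) ^ 3 / (27 * s x ^ 3) * G' (w x)" if "0 < x" for x
    using one_w3[OF that] by (simp add: Q_def)
  have dGw: "((\<lambda>x. cubic_G (w x)) has_real_derivative G' (w x) * w' x) (at x)"
    if "0 < x" "x < 5/4" for x
    using that w_dom by (intro DERIV_chain2[OF G dw]) auto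
  have dQw: "((\<lambda>x. Q (w x)) has_real_derivative w x * cubic_G (w x) * w' x) (at x)"
    if "0 < x" "x < 5/4" for x
    unfolding Q_def using that w_dom by (intro DERIV_chain2[OF Q dw]) auto
  have "cubic_G x = cubic_G (w x) / s x"
  proof (rule singular_sturm_liouville_unique[where a = 0 and b = "5/4" and c = 1
        and p = "\<lambda>x. 1 - x ^ 3" and q = "\<lambda>x. x" and u = cubic_G and u' = G' and U = Q
        and v = "\<lambda>x. cubic_G (w x) / s x" and v' = v' and V = V])
    show "cubic_G 1 = cubic_G (w 1) / s 1" by (simp add: w_def s_def)
    show "1 - x ^ 3 \<noteq> 0" if "0 < x" "x < 1" for x :: real
      using power_strict_mono[of x 1 3] that by auto
    show "cubic_G x > 0" if "0 < x" "x \<le> 1" for x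
    proof -
      have "0 < x ^ 3" "x ^ 3 \<le> 1" using that by (auto intro: power_le_one)
      then show ?thesis
        using hypergeom_1_ge_1[of "1/3" "1/3" "1 - x ^ 3"] by (simp add: cubic_G_def)
    qed
  next
    fix x :: real assume x: "0 < x" "x < 5/4"
    note x3 = cube_less[OF x] and sp = s_pos[OF x(1)]
    show "(cubic_G has_real_derivative G' x) (at x)" using G x x3 by simp
    show "((\<lambda>x. cubic_G (w x) / s x) has_real_derivative v' x) (at x)"
      using sp by (auto intro!: derivative_eq_intros dGw ds x simp: v'_def power2_eq_square)
    show "Q x = (1 - x ^ 3) * G' x" by (simp add: Q_def)
    show "(Q has_real_derivative x * cubic_G x) (at x)" unfolding Q_def using Q x x3 by simp
    have p: "1 - x ^ 3 = 3 * (1 - x) * s x ^ 3"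
      unfolding s3[OF x(1)] by (simp add: algebra_simps power2_eq_square power3_eq_cube)
    show "V x = (1 - x ^ 3) * v' x"
      unfolding p V_def v'_def Qw[OF x(1)] w'_def s'_def using sp
      by (simp add: field_simps) (simp add: algebra_simps eval_nat_numeral)
    define y where "y = s x"
    \<comment> \<open>The factor 1 - 4 x is the derivative of (1 - x) (2 x + 1).\<close>
    have "(V has_real_derivative
        3 * s' x * Q (w x) + 3 * s x * (w x * cubic_G (w x) * w' x)
        - (((1 - 4 * x) * cubic_G (w x) + (1 - x) * (2 * x + 1) * (G' (w x) * w' x)) * (3 * s x)
          - (1 - x) * (2 * x + 1) * cubic_G (w x) * (3 * s' x)) / (3 * s x)\<^sup>2) (at x)"
      unfolding V_def using sp
      by (auto intro!: derivative_eq_intros dGw dQw ds x simp: power2_eq_square algebra_simps)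
    \<comment> \<open>Both parts contribute the same term in \<open>G' (w x)\<close>, namely (1 -
      x)^3 (2 x + 1) \<open>G' (w x)\<close> / (81 s^5), with opposite signs; only multiples of
      \<open>cubic_G (w x)\<close> survive.\<close>
    also have "3 * s' x * Q (w x) + 3 * s x * (w x * cubic_G (w x) * w' x)
        - (((1 - 4 * x) * cubic_G (w x) + (1 - x) * (2 * x + 1) * (G' (w x) * w' x)) * (3 * s x)
          - (1 - x) * (2 * x + 1) * cubic_G (w x) * (3 * s' x)) / (3 * s x)\<^sup>2
        = cubic_G (w x) * ((x + 2) * (1 - x)\<^sup>2 + (1 - x) * (2 * x + 1)\<^sup>2
            - 9 * s x ^ 3 * (1 - 4 * x)) / (27 * s x ^ 4)"
    proof -
      have "3 * s' x * Q (w x) = (1 - x) ^ 3 * (2 * x + 1) * G' (w x) / (81 * s x ^ 5)"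
        unfolding Qw[OF x(1)] s'_def using sp by (simp add: field_simps eval_nat_numeral)
      moreover have "3 * s x * (w x * cubic_G (w x) * w' x)
          = cubic_G (w x) * ((x + 2) * (1 - x)\<^sup>2) / (27 * s x ^ 4)"
        unfolding w'_def using sp by (simp add: w_def field_simps)
      moreover have "(((1 - 4 * x) * cubic_G (w x) + (1 - x) * (2 * x + 1) * (G' (w x) * w' x)) * (3 * s x)
          - (1 - x) * (2 * x + 1) * cubic_G (w x) * (3 * s' x)) / (3 * s x)\<^sup>2
          = cubic_G (w x) * (9 * s x ^ 3 * (1 - 4 * x) - (1 - x) * (2 * x + 1)\<^sup>2) / (27 * s x ^ 4)
            + (1 - x) ^ 3 * (2 * x + 1) * G' (w x) / (81 * s x ^ 5)"
        unfolding w'_def s'_def using sp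
        by (simp add: field_simps) (simp add: algebra_simps eval_nat_numeral)
      ultimately show ?thesis by (simp add: diff_divide_distrib add_divide_distrib algebra_simps)
    qed
    also have "(x + 2) * (1 - x)\<^sup>2 + (1 - x) * (2 * x + 1)\<^sup>2 - 9 * s x ^ 3 * (1 - 4 * x)
        = 27 * s x ^ 3 * x"
      unfolding s3[OF x(1)] by (simp add: field_simps power2_eq_square power3_eq_cube)
    also have "cubic_G (w x) * (27 * s x ^ 3 * x) / (27 * s x ^ 4) = x * (cubic_G (w x) / s x)"
      using sp by (simp add: eval_nat_numeral)
    finally show "(V has_real_derivative x * (cubic_G (w x) / s x)) (at x)" .
  qed (use x in auto)
  then show ?thesis by (simp add: w_def)
qed

section \<open>Convergence of the cubic iteration\<close>

text \<open>The identities b'^3 - a'^3 = (b - a)^3 / 27 and b^3 - b'^3 = (b - a) b (a + 2 b) / 3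
  place b' between a' and b. Since b - a' = (b - a) / 3, the gap shrinks at least threefold.\<close>

lemma cubic_step_gap:
  fixes a b :: real
  assumes "0 < a" "0 < b"
  defines "a' \<equiv> (a + 2 * b) / 3" and "b' \<equiv> root 3 (b * (a\<^sup>2 + a * b + b\<^sup>2) / 3)"
  shows "0 < b'" "a < b \<Longrightarrow> a' < b'" "\<bar>b' - a'\<bar> \<le> \<bar>b - a\<bar> / 3"
proof -
  have pos: "0 < b * (a\<^sup>2 + a * b + b\<^sup>2) / 3" using assms(1,2) by (simp add: add_pos_pos)
  then show b': "0 < b'" by (simp add: b'_def)
  have b3: "b' ^ 3 = b * (a\<^sup>2 + a * b + b\<^sup>2) / 3" using pos by (simp add: b'_def)
  have a': "0 < a'" using assms(1,2) by (simp add: a'_def)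
  have gap: "b' ^ 3 - a' ^ 3 = (b - a) ^ 3 / 27"
    unfolding b3 by (simp add: a'_def field_simps power2_eq_square power3_eq_cube)
  have drop: "b ^ 3 - b' ^ 3 = (b - a) * (b * (a + 2 * b) / 3)"
    unfolding b3 by (simp add: field_simps power2_eq_square power3_eq_cube)
  have step: "b - a' = (b - a) / 3" by (simp add: a'_def field_simps)
  show "a' < b'" if "a < b"
  proof -
    have "0 < (b - a) ^ 3 / 27" using that by simp
    then show ?thesis using gap b' by (intro power_less_imp_less_base[of a' 3 b']) linarith+
  qed
  show "\<bar>b' - a'\<bar> \<le> \<bar>b - a\<bar> / 3"
  proof (cases "a \<le> b")
    case True
    have "0 \<le> (b - a) ^ 3 / 27" using True by simp
    then have "a' \<le> b'"
      using gap b' by (intro power_mono_iff[of a' b' 3, THEN iffD1]) (use a' in linarith)+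
    moreover have "0 \<le> (b - a) * (b * (a + 2 * b) / 3)" using True assms(1,2) by simp
    then have "b' \<le> b"
      using drop b' assms(2) by (intro power_mono_iff[of b' b 3, THEN iffD1]) linarith+
    ultimately show ?thesis using True step by simp
  next
    case False
    have "0 \<le> (a - b) ^ 3 / 27" using False by simp
    moreover have "(a - b) ^ 3 = - ((b - a) ^ 3)" by (simp add: algebra_simps power3_eq_cube)
    ultimately have "b' \<le> a'"
      using gap b' by (intro power_mono_iff[of b' a' 3, THEN iffD1]) (use a' in linarith)+
    moreover have "(b - a) * (b * (a + 2 * b) / 3) \<le> 0"
      using False assms(1,2) by (intro mult_nonpos_nonneg) auto
    then have "b \<le> b'"
      using drop b' assms(2) by (intro power_mono_iff[of b b' 3, THEN iffD1]) linarith+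
    ultimately show ?thesis using False step by simp
  qed
qed

lemma cubic_pos:
  assumes "0 < a" "0 < b"
  shows "0 < cubic_a a b n \<and> 0 < cubic_b a b n"
proof (induction n)
  case (Suc n)
  then show ?case using cubic_step_gap(1)[of "cubic_a a b n" "cubic_b a b n"] by simp
qed (use assms in simp)

lemma cubic_gap:
  assumes "0 < a" "0 < b"
  shows "\<bar>cubic_b a b n - cubic_a a b n\<bar> \<le> \<bar>b - a\<bar> * (1/3) ^ n"
proof (induction n)
  case (Suc n)
  then show ?case
    using cubic_step_gap(3)[of "cubic_a a b n" "cubic_b a b n"] cubic_pos[OF assms, of n] by simp
qed simp

text \<open>The increments of \<open>cubic_a\<close> are 2/3 of the gaps, which are dominated by a
  geometric series; telescoping gives a limit. Uniqueness of limits identifies it with the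
  \<open>THE\<close> value.\<close>

lemma cubic_mean_limits:
  assumes "0 < a" "0 < b"
  shows "cubic_a a b \<longlonglongrightarrow> cubic_mean a b" "cubic_b a b \<longlonglongrightarrow> cubic_mean a b"
proof -
  have geom: "summable (\<lambda>n. \<bar>b - a\<bar> * (1/3) ^ n)"
    by (intro summable_mult summable_geometric) simp
  have "summable (\<lambda>n. cubic_b a b n - cubic_a a b n)"
    using cubic_gap[OF assms] by (intro summable_comparison_test'[OF geom]) simp
  then have diff: "(\<lambda>n. cubic_b a b n - cubic_a a b n) \<longlonglongrightarrow> 0"
    and "summable (\<lambda>n. 2 / 3 * (cubic_b a b n - cubic_a a b n))"
    by (rule summable_LIMSEQ_zero, rule summable_mult)
  moreover have "2 / 3 * (cubic_b a b n - cubic_a a b n) = cubic_a a b (Suc n) - cubic_a a b n" for n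
    by (simp add: field_simps)
  ultimately have "summable (\<lambda>n. cubic_a a b (Suc n) - cubic_a a b n)" by (simp only:)
  from summable_LIMSEQ[OF this] obtain d where "(\<lambda>n. cubic_a a b n - cubic_a a b 0) \<longlonglongrightarrow> d"
    by (simp only: sum_lessThan_telescope)
  from tendsto_add[OF this tendsto_const[of "cubic_a a b 0"]]
  obtain l where A: "cubic_a a b \<longlonglongrightarrow> l" by auto
  from tendsto_add[OF A diff] have B: "cubic_b a b \<longlonglongrightarrow> l" by simp
  have "cubic_mean a b = l"
    unfolding cubic_mean_def using A B by (intro the_equality) (auto intro: LIMSEQ_unique)
  with A B show "cubic_a a b \<longlonglongrightarrow> cubic_mean a b" "cubic_b a b \<longlonglongrightarrow> cubic_mean a b" by auto
qed

text \<open>Keeps the ratio a_n / b_n below 1, where \<open>cubic_G_transform\<close>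
  applies.\<close>

lemma cubic_a_less_b:
  assumes "0 < a" "a < b"
  shows "cubic_a a b n < cubic_b a b n"
proof (induction n)
  case (Suc n)
  then show ?case
    using cubic_step_gap(2)[of "cubic_a a b n" "cubic_b a b n"] cubic_pos[of a b n] assms by simp
qed (use assms in simp)

text \<open>Each new a_n averages the old one with the larger b_n, so the sequence stays above its
  start.\<close>

lemma cubic_mean_pos:
  assumes "0 < a" "a < b"
  shows "0 < cubic_mean a b"
proof -
  have "a \<le> cubic_a a b n" for n
  proof (induction n)
    case (Suc n)
    then show ?case using cubic_a_less_b[OF assms, of n] by simp
  qed simp
  then have "a \<le> cubic_mean a b"
    using assms by (intro LIMSEQ_le_const[OF cubic_mean_limits(1)]) auto
  then show ?thesis using assms by simp
qed

section \<open>The invariant and the value of the limit\<close>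

lemma cubic_G_invariant:
  assumes "0 < x" "x < 1"
  shows "cubic_G (cubic_a x 1 n / cubic_b x 1 n) / cubic_b x 1 n = cubic_G x"
proof (induction n)
  case (Suc n)
  let ?a = "cubic_a x 1 n" and ?b = "cubic_b x 1 n"
  have ab: "0 < ?a" "?a < ?b" "0 < ?b"
    using cubic_pos[of x 1 n] cubic_a_less_b[of x 1 n] assms by auto
  \<comment> \<open>Homogeneity: pulling out \<open>?b ^ 3\<close> reduces the step to the ratio
    \<open>?a / ?b\<close>, with \<open>?b\<close> scaled by the factor s of
    \<open>cubic_G_transform\<close>.\<close>
  have "?b * (?a\<^sup>2 + ?a * ?b + ?b\<^sup>2) / 3 = ?b ^ 3 * (((?a / ?b)\<^sup>2 + ?a / ?b + 1) / 3)"
    using ab by (simp add: field_simps power2_eq_square power3_eq_cube)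
  then have b': "cubic_b x 1 (Suc n) = ?b * root 3 (((?a / ?b)\<^sup>2 + ?a / ?b + 1) / 3)"
    using ab by (simp only: cubic_b.simps real_root_mult real_root_power_cancel)
  have a': "cubic_a x 1 (Suc n) = ?b * ((?a / ?b + 2) / 3)"
    using ab by (simp add: field_simps)
  have "cubic_G (?a / ?b) = cubic_G (cubic_a x 1 (Suc n) / cubic_b x 1 (Suc n))
      / (cubic_b x 1 (Suc n) / ?b)"
    unfolding a' b' using cubic_G_transform[of "?a / ?b"] ab by simp
  then show ?case using Suc.IH ab by simp
qed simp

text \<open>Passage to the limit in the invariant: the ratio tends to 1 because the common limit is
  nonzero, and \<open>cubic_G\<close> is continuous at 1 with value 1.\<close>

lemma cubic_mean_eq_cubic_G:
  assumes "0 < x" "x < 1"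
  shows "1 / cubic_mean x 1 = cubic_G x"
proof -
  have L: "cubic_mean x 1 \<noteq> 0" using cubic_mean_pos assms by (simp add: less_imp_neq[symmetric])
  have A: "cubic_a x 1 \<longlonglongrightarrow> cubic_mean x 1" and B: "cubic_b x 1 \<longlonglongrightarrow> cubic_mean x 1"
    using cubic_mean_limits[of x 1] assms by auto
  obtain G' where "(cubic_G has_real_derivative G' 1) (at 1)"
    by (rule cubic_G_ode) force
  then have "isCont cubic_G 1" by (rule DERIV_isCont)
  moreover have "(\<lambda>n. cubic_a x 1 n / cubic_b x 1 n) \<longlonglongrightarrow> 1"
    using tendsto_divide[OF A B L] L by simp
  ultimately have "(\<lambda>n. cubic_G (cubic_a x 1 n / cubic_b x 1 n)) \<longlonglongrightarrow> cubic_G 1"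
    by (rule isCont_tendsto_compose)
  from tendsto_divide[OF this B L]
  have "(\<lambda>n. cubic_G x) \<longlonglongrightarrow> 1 / cubic_mean x 1"
    using assms by (simp add: cubic_G_invariant cubic_G_1)
  then show ?thesis by (simp add: LIMSEQ_const_iff)
qed

theorem theorem1p4:
  shows "(\<forall>a b :: real. 0 < a \<longrightarrow> 0 < b \<longrightarrow>
           cubic_a a b \<longlonglongrightarrow> cubic_mean a b \<and> cubic_b a b \<longlonglongrightarrow> cubic_mean a b) \<and>
         (\<forall>x :: real. 0 < x \<longrightarrow> x < 1 \<longrightarrow>
           (\<lambda>n. (pochhammer (1/3) n)\<^sup>2 / (fact n)\<^sup>2 * (1 - x ^ 3) ^ n) sums (1 / cubic_mean x 1) \<and>
           1 / cubic_mean x 1 = hypergeom (1/3) (1/3) 1 (1 - x ^ 3)) \<and>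
         (\<forall>x :: real. 0 < x \<longrightarrow> x < 1 \<longrightarrow>
           hypergeom (1/3) (1/3) 1 (1 - x ^ 3) =
             root 3 (3 / (x\<^sup>2 + x + 1)) *
             hypergeom (1/3) (1/3) 1 ((1 - x) ^ 3 / (9 * (x\<^sup>2 + x + 1))))"
proof (intro conjI allI impI)
  fix a b :: real assume "0 < a" "0 < b"
  then show "cubic_a a b \<longlonglongrightarrow> cubic_mean a b" "cubic_b a b \<longlonglongrightarrow> cubic_mean a b"
    by (rule cubic_mean_limits)+
next
  fix x :: real assume x: "0 < x" "x < 1"
  show mean: "1 / cubic_mean x 1 = hypergeom (1/3) (1/3) 1 (1 - x ^ 3)"
    using cubic_mean_eq_cubic_G[OF x] by (simp add: cubic_G_def)
  have "0 < x ^ 3" "x ^ 3 < 1" using x power_strict_mono[of x 1 3] by auto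
  then have "summable (\<lambda>n. hypergeom_coeff (1/3) (1/3) n * (1 - x ^ 3) ^ n)"
    by (intro summable_hypergeom_coeff) auto
  then show "(\<lambda>n. (pochhammer (1/3) n)\<^sup>2 / (fact n)\<^sup>2 * (1 - x ^ 3) ^ n) sums (1 / cubic_mean x 1)"
    unfolding mean hypergeom_1_eq
    by (simp add: summable_sums hypergeom_coeff_def power2_eq_square)
next
  fix x :: real assume x: "0 < x" "x < 1"
  \<comment> \<open>\<open>?s\<close> and \<open>(x + 2) / (3 * ?s)\<close> are the scale and the
    new ratio in \<open>cubic_G_transform\<close>; it remains to rewrite 1 minus the cube of that
    ratio, and 1 / \<open>?s\<close>, without \<open>?s\<close>.\<close>
  let ?s = "root 3 ((x\<^sup>2 + x + 1) / 3)"
  have q: "0 < x\<^sup>2 + x + 1" using x by (simp add: add_pos_pos)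
  have "?s ^ 3 = (x\<^sup>2 + x + 1) / 3" using q by simp
  then have "((x + 2) / (3 * ?s)) ^ 3 = (x + 2) ^ 3 / (27 * ((x\<^sup>2 + x + 1) / 3))"
    by (simp only: power_divide power_mult_distrib) simp
  also have "27 * ((x\<^sup>2 + x + 1) / 3) = 9 * (x\<^sup>2 + x + 1)" by simp
  finally have "((x + 2) / (3 * ?s)) ^ 3 = (x + 2) ^ 3 / (9 * (x\<^sup>2 + x + 1))" .
  then have "1 - ((x + 2) / (3 * ?s)) ^ 3 = (1 - x) ^ 3 / (9 * (x\<^sup>2 + x + 1))"
    using q by (simp add: field_simps) (simp add: algebra_simps eval_nat_numeral)
  moreover have "root 3 (3 / (x\<^sup>2 + x + 1)) = 1 / ?s"
    by (simp add: real_root_divide)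
  ultimately show "hypergeom (1/3) (1/3) 1 (1 - x ^ 3) =
      root 3 (3 / (x\<^sup>2 + x + 1)) * hypergeom (1/3) (1/3) 1 ((1 - x) ^ 3 / (9 * (x\<^sup>2 + x + 1)))"
    using cubic_G_transform[OF x] by (simp add: cubic_G_def)
qed

end
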